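(* A finite diversity $(X,\delta)$ is sublinear-embeddable if and only if there are (finitely many, $m\ge1$) submodular diversities $(X,\delta_1),(X,\delta_2),\ldots,(X,\delta_m)$ such that $$\delta(A)=\max\{\delta_1(A),\ldots,\delta_m(A)\}$$ for all $A\subseteq X$.
   Context: A diversity is a pair $(X,\delta)$ where $X$ is a set and $\delta$ is a real-valued function on finite subsets of $X$ satisfying (D1') $\delta(A)=0$ if $|A|\le 1$, and (D2) $\delta(A\cup C)\le \delta(A\cup B)+\delta(B\cup C)$ for all finite $A,B,C\subseteq X$ with $B\neq\emptyset$. (So $\delta$ may vanish on sets with two or more elements.) The diversity is finite if $X$ is finite. A diversity $(X,\delta)$ is submodular if $\delta(A\cup B)+\delta(A\cap B)\le\delta(A)+\delta(B)$ for all $A,B$ with $A\cap B\neq\emptyset$. A diversity $(\mathbb{R}^k,\delta)$ is sublinear if $\delta(\lambda A)=\lambda\delta(A)$ and $\delta(A+B)\le\delta(A)+\delta(B)$ for all $\lambda\ge 0$ and all nonempty finite $A,B\subseteq\mathbb{R}^k$, where $\lambda A=\{\lambda a:a\in A\}$ and $A+B=\{a+b:a\in A,\,b\in B\}$. An (isometric) embedding of a diversity $(X,\delta_X)$ into a diversity $(Y,\delta_Y)$ is a map $\phi:X\to Y$ (not required to be injective) such that $\delta_Y(\phi(A))=\delta_X(A)$ for all finite $A\subseteq X$. A diversity is sublinear-embeddable if it has an isometric embedding into a sublinear diversity on $\mathbb{R}^k$ for some $k$. *)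

theory Defs
  imports Complex_Main "Jordan_Normal_Form.Matrix"
begin

text \<open>
  A diversity on a carrier set \<open>X\<close> is represented by a total function on sets; only its values on
  finite subsets of \<open>X\<close> are relevant.  It may vanish on sets with two or more elements.
\<close>

definition diversity :: "'a set \<Rightarrow> ('a set \<Rightarrow> real) \<Rightarrow> bool" where
  "diversity X \<delta> \<longleftrightarrow>
     (\<forall>A. finite A \<and> A \<subseteq> X \<and> card A \<le> 1 \<longrightarrow> \<delta> A = 0) \<and>
     (\<forall>A B C. finite A \<and> A \<subseteq> X \<and> finite B \<and> B \<subseteq> X \<and> finite C \<and> C \<subseteq> X \<and> B \<noteq> {} \<longrightarrow>
        \<delta> (A \<union> C) \<le> \<delta> (A \<union> B) + \<delta> (B \<union> C))"

definition submodular_diversity :: "'a set \<Rightarrow> ('a set \<Rightarrow> real) \<Rightarrow> bool" where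
  "submodular_diversity X \<delta> \<longleftrightarrow>
     diversity X \<delta> \<and>
     (\<forall>A B. finite A \<and> A \<subseteq> X \<and> finite B \<and> B \<subseteq> X \<and> A \<inter> B \<noteq> {} \<longrightarrow>
        \<delta> (A \<union> B) + \<delta> (A \<inter> B) \<le> \<delta> A + \<delta> B)"

text \<open>
  The space $\mathbb{R}^k$ is \<open>carrier_vec k\<close>, so that the dimension \<open>k\<close> can be quantified over.
\<close>

definition sublinear_diversity :: "nat \<Rightarrow> (real vec set \<Rightarrow> real) \<Rightarrow> bool" where
  "sublinear_diversity k \<delta> \<longleftrightarrow>
     diversity (carrier_vec k) \<delta> \<and>
     (\<forall>c A. 0 \<le> c \<and> finite A \<and> A \<noteq> {} \<and> A \<subseteq> carrier_vec k \<longrightarrow>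
        \<delta> ((\<lambda>a. c \<cdot>\<^sub>v a) ` A) = c * \<delta> A) \<and>
     (\<forall>A B. finite A \<and> A \<noteq> {} \<and> A \<subseteq> carrier_vec k \<and>
            finite B \<and> B \<noteq> {} \<and> B \<subseteq> carrier_vec k \<longrightarrow>
        \<delta> {a + b |a b. a \<in> A \<and> b \<in> B} \<le> \<delta> A + \<delta> B)"

definition diversity_embedding ::
    "'a set \<Rightarrow> ('a set \<Rightarrow> real) \<Rightarrow> 'b set \<Rightarrow> ('b set \<Rightarrow> real) \<Rightarrow> ('a \<Rightarrow> 'b) \<Rightarrow> bool" where
  "diversity_embedding X \<delta>X Y \<delta>Y \<phi> \<longleftrightarrow>
     \<phi> ` X \<subseteq> Y \<and> (\<forall>A. finite A \<and> A \<subseteq> X \<longrightarrow> \<delta>Y (\<phi> ` A) = \<delta>X A)"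

definition sublinear_embeddable :: "'a set \<Rightarrow> ('a set \<Rightarrow> real) \<Rightarrow> bool" where
  "sublinear_embeddable X \<delta> \<longleftrightarrow>
     (\<exists>k \<delta>' \<phi>. sublinear_diversity k \<delta>' \<and> diversity_embedding X \<delta> (carrier_vec k) \<delta>' \<phi>)"

end

theory Submission
  imports Defs
begin

text \<open>
  Both directions reduce to one set at a time: a function on the finitely many subsets of \<open>X\<close> is a
  maximum of members of some class as soon as, for every \<open>A0 \<subseteq> X\<close>, the class contains a minorant
  that is tight at \<open>A0\<close>.

  For a sublinear diversity \<open>\<delta>'\<close>, the inclusion
  \<open>(A \<union> B) + (A \<inter> B) \<subseteq> A + B\<close> of Minkowski sums shows that every monotone
  functional that is additive on Minkowski sums is submodular on intersecting sets; what is missing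
  is additivity.  It is enforced in one direction \<open>b\<close> at a time by passing from \<open>f\<close> to
  \<open>g x = lim (f (x + n b) - n f b)\<close>.  This limit is a pointwise smaller or equal functional of the
  same kind, with \<open>g b = f b\<close>, it is additive along \<open>b\<close>, and it stays additive in the directions where
  \<open>f\<close> was additive.  Treating first the image of \<open>A0\<close>, and then the images of the
  other nonempty subsets of \<open>X\<close>, gives the submodular minorant
  (\<open>gauge_minorant_additive_along\<close>, \<open>submodular_minorant_of_sublinear\<close>).

  For a submodular diversity \<open>d\<close>, send the points of \<open>X\<close> to the unit vectors and look for linear
  functionals with sum zero, that is, for functions \<open>u\<^sub>i\<close> on \<open>X\<close> with sum zero.  The sum of
  the support functions \<open>max\<^bsub>x \<in> S\<^esub> u\<^sub>i x\<close> is then a sublinear diversity.  Order \<open>A0\<close>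
  and let \<open>Y\<^sub>i\<close> be its initial segments; put
  \<open>u\<^sub>i x = d (Y\<^sub>i \<union> {x}) - d (Y\<^sub>i\<^sub>+\<^sub>1 \<union> {x})\<close>, and let the last function be
  \<open>d (A0 \<union> {x})\<close>.  By submodularity
  \<open>u\<^sub>i x \<le> d (Y\<^sub>i \<union> S) - d (Y\<^sub>i\<^sub>+\<^sub>1 \<union> S)\<close> for \<open>x \<in> S\<close>, and the sum of these
  bounds telescopes to \<open>d S\<close>, while for \<open>S = A0\<close> equality holds
  (\<open>submodular_support_minorant\<close>).
\<close>

section \<open>Diversities\<close>

lemma diversity_D1:
  "diversity X \<delta> \<Longrightarrow> finite A \<Longrightarrow> A \<subseteq> X \<Longrightarrow> card A \<le> 1 \<Longrightarrow> \<delta> A = 0"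
  unfolding diversity_def by blast

lemma diversity_D2:
  "diversity X \<delta> \<Longrightarrow> finite A \<Longrightarrow> A \<subseteq> X \<Longrightarrow> finite B \<Longrightarrow> B \<subseteq> X \<Longrightarrow> finite C \<Longrightarrow> C \<subseteq> X
    \<Longrightarrow> B \<noteq> {} \<Longrightarrow> \<delta> (A \<union> C) \<le> \<delta> (A \<union> B) + \<delta> (B \<union> C)"
  unfolding diversity_def by blast

lemma diversity_empty: "diversity X \<delta> \<Longrightarrow> \<delta> {} = 0"
  by (rule diversity_D1) auto

lemma diversity_singleton: "diversity X \<delta> \<Longrightarrow> x \<in> X \<Longrightarrow> \<delta> {x} = 0"
  by (rule diversity_D1) auto

text \<open>
  Adding one point \<open>c\<close> does not decrease a diversity: apply the triangle inequality through
  \<open>{c}\<close>, whose own value is zero, with empty third set.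
\<close>

lemma diversity_mono:
  assumes "diversity X \<delta>" "finite B" "A \<subseteq> B" "B \<subseteq> X"
  shows "\<delta> A \<le> \<delta> B"
proof -
  have "\<delta> A \<le> \<delta> (A \<union> C)" if "finite C" "C \<subseteq> B" for C
    using that
  proof (induction C)
    case (insert c C)
    have fin: "finite A" using assms finite_subset by blast
    have "\<delta> ((A \<union> C) \<union> {}) \<le> \<delta> ((A \<union> C) \<union> {c}) + \<delta> ({c} \<union> {})"
      by (rule diversity_D2[OF assms(1)]) (use insert assms fin in auto)
    moreover have "\<delta> {c} = 0"
      using insert assms by (intro diversity_singleton[OF assms(1)]) auto
    ultimately show ?case using insert by simp
  qed simp
  from this[of B] show ?thesis using assms by (simp add: Un_absorb1)
qed

lemma diversity_nonneg:
  "diversity X \<delta> \<Longrightarrow> finite A \<Longrightarrow> A \<subseteq> X \<Longrightarrow> 0 \<le> \<delta> A"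
  using diversity_mono[of X \<delta> A "{}"] diversity_empty[of X \<delta>] by simp

text \<open>
  The triangle inequality is a consequence of the other properties: submodularity applied to
  \<open>A \<union> B\<close> and \<open>B \<union> C\<close>, which meet in \<open>B\<close>, bounds \<open>d (A \<union> B \<union> C)\<close>.
\<close>

lemma submodular_diversityI:
  assumes empty: "d {} = 0"
    and single: "\<And>x. x \<in> X \<Longrightarrow> d {x} = 0"
    and mono: "\<And>A B. A \<subseteq> B \<Longrightarrow> finite B \<Longrightarrow> B \<subseteq> X \<Longrightarrow> d A \<le> d B"
    and submod: "\<And>A B. finite A \<Longrightarrow> A \<subseteq> X \<Longrightarrow> finite B \<Longrightarrow> B \<subseteq> X \<Longrightarrow> A \<inter> B \<noteq> {} \<Longrightarrow>
        d (A \<union> B) + d (A \<inter> B) \<le> d A + d B"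
  shows "submodular_diversity X d"
proof -
  have D1: "d A = 0" if "finite A" "A \<subseteq> X" "card A \<le> 1" for A
  proof (cases "A = {}")
    case False
    with that have "card A = 1" by (simp add: le_Suc_eq)
    then obtain x where "A = {x}" by (rule card_1_singletonE)
    with that single show ?thesis by simp
  qed (simp add: empty)
  have D2: "d (A \<union> C) \<le> d (A \<union> B) + d (B \<union> C)"
    if *: "finite A" "A \<subseteq> X" "finite B" "B \<subseteq> X" "finite C" "C \<subseteq> X" "B \<noteq> {}" for A B C
  proof -
    have "d (A \<union> C) \<le> d ((A \<union> B) \<union> (B \<union> C))"
      by (rule mono) (use * in auto)
    moreover have "d {} \<le> d ((A \<union> B) \<inter> (B \<union> C))"
      by (rule mono) (use * in auto)
    moreover have "d ((A \<union> B) \<union> (B \<union> C)) + d ((A \<union> B) \<inter> (B \<union> C)) \<le> d (A \<union> B) + d (B \<union> C)"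
      by (rule submod) (use * in auto)
    ultimately show ?thesis using empty by simp
  qed
  show ?thesis
    unfolding submodular_diversity_def diversity_def
    by (intro conjI allI impI; elim conjE; rule D1 D2 submod; assumption)
qed

section \<open>Additive minorants of gauges on commutative monoids\<close>

text \<open>
  The properties of a sublinear diversity that only mention Minkowski sums.  Homogeneity is
  required for multiples by natural numbers, which are powers in the monoid, and the last clause
  replaces invariance under translations: adding an element never makes the value smaller.
\<close>

definition gauge :: "('m, 'n) monoid_scheme \<Rightarrow> ('m \<Rightarrow> 'm \<Rightarrow> bool) \<Rightarrow> ('m \<Rightarrow> real) \<Rightarrow> bool" where
  "gauge G R f \<longleftrightarrow>
     (\<forall>x\<in>carrier G. \<forall>y\<in>carrier G. f (x \<otimes>\<^bsub>G\<^esub> y) \<le> f x + f y) \<and>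
     (\<forall>x\<in>carrier G. \<forall>n::nat. f (x [^]\<^bsub>G\<^esub> n) = real n * f x) \<and>
     (\<forall>x\<in>carrier G. \<forall>y\<in>carrier G. R x y \<longrightarrow> f x \<le> f y) \<and>
     (\<forall>x\<in>carrier G. \<forall>y\<in>carrier G. f x \<le> f (x \<otimes>\<^bsub>G\<^esub> y))"

definition additive_along :: "('m, 'n) monoid_scheme \<Rightarrow> ('m \<Rightarrow> real) \<Rightarrow> 'm \<Rightarrow> bool" where
  "additive_along G f b \<longleftrightarrow> (\<forall>x\<in>carrier G. f (x \<otimes>\<^bsub>G\<^esub> b) = f x + f b)"

lemma gauge_one:
  assumes "comm_monoid G" "gauge G R f"
  shows "f \<one>\<^bsub>G\<^esub> = 0"
proof -
  interpret comm_monoid G by fact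
  have "f (\<one>\<^bsub>G\<^esub> [^]\<^bsub>G\<^esub> (0::nat)) = real 0 * f \<one>\<^bsub>G\<^esub>"
    using assms(2) one_closed unfolding gauge_def by blast
  then show ?thesis by simp
qed

lemma gauge_nonneg:
  assumes "comm_monoid G" "gauge G R f" "x \<in> carrier G"
  shows "0 \<le> f x"
proof -
  interpret comm_monoid G by fact
  have "f \<one>\<^bsub>G\<^esub> \<le> f (\<one>\<^bsub>G\<^esub> \<otimes>\<^bsub>G\<^esub> x)"
    using assms(2,3) one_closed unfolding gauge_def by blast
  then show ?thesis using gauge_one[OF assms(1,2)] assms(3) by simp
qed

text \<open>
  The sequence \<open>f (x \<otimes> b [^] n) - n f b\<close> is decreasing because \<open>f\<close> is subadditive, and it
  is nonnegative because \<open>f (b [^] n) = n f b\<close>; its limit \<open>g x\<close> is the slope-corrected value of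
  \<open>f\<close> infinitely far in direction \<open>b\<close>.  Each property of \<open>f\<close> passes to the sequence, possibly
  along multiples of the index, and hence to the limit.  Since \<open>x \<otimes> b\<close> only shifts the index,
  \<open>g\<close> is additive along \<open>b\<close>.
\<close>

lemma gauge_minorant_additive_along:
  fixes G (structure)
  assumes G: "comm_monoid G" and f: "gauge G R f"
    and compat: "\<And>x y z. x \<in> carrier G \<Longrightarrow> y \<in> carrier G \<Longrightarrow> z \<in> carrier G \<Longrightarrow>
        R x y \<Longrightarrow> R (x \<otimes> z) (y \<otimes> z)"
    and b: "b \<in> carrier G"
  obtains g where "gauge G R g" "\<And>x. x \<in> carrier G \<Longrightarrow> g x \<le> f x"
    "g b = f b" "additive_along G g b"
    "\<And>c. c \<in> carrier G \<Longrightarrow> additive_along G f c \<Longrightarrow> g c = f c \<and> additive_along G g c"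
proof -
  interpret comm_monoid G by (rule G)
  have sub: "f (x \<otimes> y) \<le> f x + f y" and inc: "f x \<le> f (x \<otimes> y)"
    if "x \<in> carrier G" "y \<in> carrier G" for x y
    using f that unfolding gauge_def by blast+
  have hom: "f (x [^] n) = real n * f x" if "x \<in> carrier G" for x and n :: nat
    using f that unfolding gauge_def by blast
  have mono: "f x \<le> f y" if "x \<in> carrier G" "y \<in> carrier G" "R x y" for x y
    using f that unfolding gauge_def by blast
  define h where "h x n = f (x \<otimes> b [^] n) - real n * f b" for x and n :: nat
  define g where "g x = lim (h x)" for x
  have h_Suc: "h x (Suc n) \<le> h x n" if x: "x \<in> carrier G" for x n
  proof -
    have "x \<otimes> b [^] Suc n = (x \<otimes> b [^] n) \<otimes> b"
      using x b by (simp add: m_assoc)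
    then show ?thesis
      using sub[of "x \<otimes> b [^] n" b] x b by (simp add: h_def algebra_simps)
  qed
  have h_nonneg: "0 \<le> h x n" if x: "x \<in> carrier G" for x n
    using inc[of "b [^] n" x] hom[OF b, of n] x b by (simp add: h_def m_comm)
  have lim: "h x \<longlonglongrightarrow> g x" if x: "x \<in> carrier G" for x
  proof -
    have "decseq (h x)" using h_Suc[OF x] by (rule decseq_SucI)
    then have "convergent (h x)"
      using decseq_convergent[of "h x" 0] h_nonneg[OF x] unfolding convergent_def by metis
    then show ?thesis unfolding g_def by (simp add: convergent_LIMSEQ_iff)
  qed
  have g_le: "g x \<le> f x" if x: "x \<in> carrier G" for x
  proof -
    have "decseq (h x)" using h_Suc[OF x] by (rule decseq_SucI)
    from decseq_ge[OF this lim[OF x], of 0] show ?thesis using x by (simp add: h_def)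
  qed
  have lim_mult: "(\<lambda>n. h x (m * n)) \<longlonglongrightarrow> g x" if "x \<in> carrier G" "0 < m" for x m
    using LIMSEQ_subseq_LIMSEQ[OF lim[OF that(1)], of "\<lambda>n. m * n"] that(2)
    by (simp add: strict_mono_def o_def)
  have "gauge G R g"
    unfolding gauge_def
  proof (intro conjI ballI allI impI)
    fix x y assume x: "x \<in> carrier G" and y: "y \<in> carrier G"
    \<comment> \<open>Both summands need a copy of \<open>b [^] n\<close>, hence the index \<open>2 * n\<close> on the left.\<close>
    have "h (x \<otimes> y) (2 * n) \<le> h x n + h y n" for n
    proof -
      have "b [^] (2 * n) = b [^] n \<otimes> b [^] n"
        using b by (simp add: nat_pow_mult mult_2)
      then have "(x \<otimes> y) \<otimes> b [^] (2 * n) = (x \<otimes> b [^] n) \<otimes> (y \<otimes> b [^] n)"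
        using x y b by (simp add: m_ac)
      then show ?thesis
        using sub[of "x \<otimes> b [^] n" "y \<otimes> b [^] n"] x y b by (simp add: h_def)
    qed
    then show "g (x \<otimes> y) \<le> g x + g y"
      by (intro LIMSEQ_le[OF lim_mult[of "x \<otimes> y" 2] tendsto_add[OF lim lim]]) (use x y in auto)
    show "g x \<le> g (x \<otimes> y)"
    proof (rule LIMSEQ_le[OF lim lim])
      have "x \<otimes> y \<otimes> b [^] n = (x \<otimes> b [^] n) \<otimes> y" for n :: nat
        using x y b by (simp add: m_ac)
      then show "\<exists>N. \<forall>n\<ge>N. h x n \<le> h (x \<otimes> y) n"
        using inc x y b by (auto simp: h_def)
    qed (use x y in auto)
    assume "R x y"
    then have "h x n \<le> h y n" for n
      using mono[OF _ _ compat[of x y "b [^] n"]] x y b by (simp add: h_def)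
    then show "g x \<le> g y"
      by (intro LIMSEQ_le[OF lim lim]) (use x y in auto)
  next
    fix x and m :: nat assume x: "x \<in> carrier G"
    show "g (x [^] m) = real m * g x"
    proof (cases "m = 0")
      case True
      have "h \<one> = (\<lambda>n. 0)" using hom[OF b] b by (auto simp: h_def)
      then show ?thesis using True by (simp add: g_def)
    next
      case False
      have "h (x [^] m) (m * n) = real m * h x n" for n
      proof -
        have "x [^] m \<otimes> b [^] (m * n) = (x \<otimes> b [^] n) [^] m"
          using x b by (simp add: nat_pow_distrib nat_pow_pow mult.commute)
        then show ?thesis
          using hom[of "x \<otimes> b [^] n" m] x b by (simp add: h_def algebra_simps)
      qed
      then have "(\<lambda>n. h (x [^] m) (m * n)) \<longlonglongrightarrow> real m * g x"
        using tendsto_mult_left[OF lim[OF x], of "real m"] by simp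
      with lim_mult[of "x [^] m" m] show ?thesis
        using False x LIMSEQ_unique by blast
    qed
  qed
  moreover have gb: "g b = f b"
  proof -
    have "h b n = f b" for n
      using hom[OF b, of "Suc n"] b by (simp add: h_def m_comm algebra_simps)
    then have "h b = (\<lambda>n. f b)" by auto
    then show ?thesis by (simp add: g_def)
  qed
  moreover have "additive_along G g b"
    unfolding additive_along_def
  proof
    fix x assume x: "x \<in> carrier G"
    have "h (x \<otimes> b) n = h x (Suc n) + f b" for n
      using x b by (simp add: h_def m_ac algebra_simps)
    then have "h (x \<otimes> b) = (\<lambda>n. h x (Suc n) + f b)" by auto
    moreover have "(\<lambda>n. h x (Suc n) + f b) \<longlonglongrightarrow> g x + f b"
      by (intro tendsto_add LIMSEQ_Suc[OF lim] x tendsto_const)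
    ultimately have "h (x \<otimes> b) \<longlonglongrightarrow> g x + f b"
      by simp
    with lim[of "x \<otimes> b"] show "g (x \<otimes> b) = g x + g b"
      using x b gb LIMSEQ_unique by auto
  qed
  moreover have "g c = f c \<and> additive_along G g c"
    if c: "c \<in> carrier G" and add: "additive_along G f c" for c
  proof -
    have hc: "h (x \<otimes> c) n = h x n + f c" if x: "x \<in> carrier G" for x n
    proof -
      have "(x \<otimes> c) \<otimes> b [^] n = (x \<otimes> b [^] n) \<otimes> c"
        using x b c by (simp add: m_ac)
      then show ?thesis
        using add x b unfolding additive_along_def by (simp add: h_def)
    qed
    have gc: "g (x \<otimes> c) = g x + f c" if x: "x \<in> carrier G" for x
    proof -
      have "h (x \<otimes> c) = (\<lambda>n. h x n + f c)" using hc[OF x] by auto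
      then have "h (x \<otimes> c) \<longlonglongrightarrow> g x + f c"
        using tendsto_add[OF lim[OF x] tendsto_const] by simp
      with lim[of "x \<otimes> c"] show ?thesis
        using x c LIMSEQ_unique by auto
    qed
    moreover have "g \<one> = 0"
      using gauge_one[OF G \<open>gauge G R g\<close>] .
    ultimately have "g c = f c" using gc[of \<one>] c by simp
    with gc show ?thesis by (simp add: additive_along_def)
  qed
  ultimately show thesis using that g_le by blast
qed

text \<open>
  Values in additive directions survive the later steps, so treating \<open>a\<close> first keeps
  \<open>g a = f a\<close>; the values at the other directions may drop.
\<close>

lemma gauge_minorant_additive_on_finite:
  fixes G (structure)
  assumes G: "comm_monoid G" and f: "gauge G R f"
    and compat: "\<And>x y z. x \<in> carrier G \<Longrightarrow> y \<in> carrier G \<Longrightarrow> z \<in> carrier G \<Longrightarrow>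
        R x y \<Longrightarrow> R (x \<otimes> z) (y \<otimes> z)"
    and a: "a \<in> carrier G" and B: "finite B" "B \<subseteq> carrier G"
  shows "\<exists>g. gauge G R g \<and> (\<forall>x\<in>carrier G. g x \<le> f x) \<and> g a = f a \<and>
    (\<forall>b\<in>insert a B. additive_along G g b)"
  using B
proof (induction B)
  case empty
  show ?case
    by (rule gauge_minorant_additive_along[OF G f compat a]) auto
next
  case (insert b B)
  then obtain g where g: "gauge G R g" "\<forall>x\<in>carrier G. g x \<le> f x" "g a = f a"
    "\<forall>b\<in>insert a B. additive_along G g b"
    by auto
  have b: "b \<in> carrier G" using insert by simp
  obtain g' where g': "gauge G R g'" "\<And>x. x \<in> carrier G \<Longrightarrow> g' x \<le> g x"
    "additive_along G g' b"
    "\<And>c. c \<in> carrier G \<Longrightarrow> additive_along G g c \<Longrightarrow> g' c = g c \<and> additive_along G g' c"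
    by (rule gauge_minorant_additive_along[OF G g(1) compat b]) auto
  have "\<forall>x\<in>carrier G. g' x \<le> f x" using g(2) g'(2) by (meson order_trans)
  moreover have "g' a = f a" using g(3,4) g'(4)[OF a] by simp
  moreover have "\<forall>c\<in>insert a (insert b B). additive_along G g' c"
    using g(4) g'(3,4) a insert.prems by (metis insert_iff subset_iff)
  ultimately show ?case using g'(1) by blast
qed

section \<open>From sublinear to submodular diversities\<close>

definition minkowski_monoid :: "nat \<Rightarrow> real vec set monoid" where
  "minkowski_monoid k =
     \<lparr>carrier = {A. finite A \<and> A \<noteq> {} \<and> A \<subseteq> carrier_vec k},
      mult = (\<lambda>A B. {a + b |a b. a \<in> A \<and> b \<in> B}),
      one = {0\<^sub>v k}\<rparr>"

lemma carrier_minkowski: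
  "A \<in> carrier (minkowski_monoid k) \<longleftrightarrow> finite A \<and> A \<noteq> {} \<and> A \<subseteq> carrier_vec k"
  by (simp add: minkowski_monoid_def)

lemma mult_minkowski:
  "A \<otimes>\<^bsub>minkowski_monoid k\<^esub> B = {a + b |a b. a \<in> A \<and> b \<in> B}"
  by (simp add: minkowski_monoid_def)

lemma one_minkowski: "\<one>\<^bsub>minkowski_monoid k\<^esub> = {0\<^sub>v k}"
  by (simp add: minkowski_monoid_def)

lemma comm_monoid_minkowski: "comm_monoid (minkowski_monoid k)"
proof (rule comm_monoidI)
  fix A B assume A: "A \<in> carrier (minkowski_monoid k)" and B: "B \<in> carrier (minkowski_monoid k)"
  then show "A \<otimes>\<^bsub>minkowski_monoid k\<^esub> B \<in> carrier (minkowski_monoid k)"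
    unfolding carrier_minkowski mult_minkowski
    by (auto intro!: finite_image_set2 intro: add_carrier_vec)
  show "A \<otimes>\<^bsub>minkowski_monoid k\<^esub> B = B \<otimes>\<^bsub>minkowski_monoid k\<^esub> A"
    using A B unfolding carrier_minkowski mult_minkowski
    by (auto; metis comm_add_vec subsetD)
  fix C assume C: "C \<in> carrier (minkowski_monoid k)"
  show "(A \<otimes>\<^bsub>minkowski_monoid k\<^esub> B) \<otimes>\<^bsub>minkowski_monoid k\<^esub> C =
      A \<otimes>\<^bsub>minkowski_monoid k\<^esub> (B \<otimes>\<^bsub>minkowski_monoid k\<^esub> C)"
    using A B C unfolding carrier_minkowski mult_minkowski
    by (auto; metis assoc_add_vec subsetD)
next
  fix A assume "A \<in> carrier (minkowski_monoid k)"
  then have "A \<subseteq> carrier_vec k" by (simp add: carrier_minkowski)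
  then have "0\<^sub>v k + a = a" if "a \<in> A" for a
    using that by (meson left_zero_vec subsetD)
  then show "\<one>\<^bsub>minkowski_monoid k\<^esub> \<otimes>\<^bsub>minkowski_monoid k\<^esub> A = A"
    unfolding one_minkowski mult_minkowski by force
qed (simp_all add: carrier_minkowski one_minkowski)

text \<open>
  For sets that are not convex the \<open>n\<close>-fold Minkowski sum can be strictly larger than the dilate by
  \<open>n\<close>.  The inclusion that always holds, together with monotonicity, turns homogeneity under
  dilation into homogeneity for powers.
\<close>

lemma smult_subset_pow_minkowski:
  assumes "A \<in> carrier (minkowski_monoid k)"
  shows "(\<lambda>a. real n \<cdot>\<^sub>v a) ` A \<subseteq> A [^]\<^bsub>minkowski_monoid k\<^esub> n"
proof (induction n)
  case 0
  have "(0::real) \<cdot>\<^sub>v a = 0\<^sub>v k" if "a \<in> A" for a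
    using assms that by (intro eq_vecI) (auto simp: carrier_minkowski)
  then show ?case by (auto simp: one_minkowski)
next
  case (Suc n)
  have "real (Suc n) \<cdot>\<^sub>v a = real n \<cdot>\<^sub>v a + a" for a :: "real vec"
    by (rule eq_vecI) (simp_all add: algebra_simps)
  moreover have "real n \<cdot>\<^sub>v a \<in> A [^]\<^bsub>minkowski_monoid k\<^esub> n" if "a \<in> A" for a
    using Suc that by blast
  ultimately show ?case
    by (simp add: mult_minkowski image_subset_iff del: of_nat_Suc) blast
qed

text \<open>
  Translations do not change a sublinear diversity, as a translation by \<open>b\<close> is a sum with
  \<open>{b}\<close>, which has value zero, and is undone by adding \<open>{- b}\<close>.  So \<open>A + B\<close>, which contains a
  translate of \<open>A\<close>, is at least as large as \<open>A\<close>.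
\<close>

lemma sublinear_diversity_gauge:
  assumes "sublinear_diversity k \<delta>"
  shows "gauge (minkowski_monoid k) (\<subseteq>) \<delta>"
proof -
  let ?G = "minkowski_monoid k"
  interpret comm_monoid ?G by (rule comm_monoid_minkowski)
  have div: "diversity (carrier_vec k) \<delta>"
    using assms by (simp add: sublinear_diversity_def)
  have hom: "\<delta> ((\<lambda>a. c \<cdot>\<^sub>v a) ` A) = c * \<delta> A" if "0 \<le> c" "A \<in> carrier ?G" for c A
    using assms that unfolding sublinear_diversity_def carrier_minkowski by blast
  have sub: "\<delta> (A \<otimes>\<^bsub>?G\<^esub> B) \<le> \<delta> A + \<delta> B" if "A \<in> carrier ?G" "B \<in> carrier ?G" for A B
    using assms that unfolding sublinear_diversity_def carrier_minkowski mult_minkowski by blast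
  have mono: "\<delta> A \<le> \<delta> B" if "A \<subseteq> B" "B \<in> carrier ?G" for A B
    using that by (intro diversity_mono[OF div]) (auto simp: carrier_minkowski)
  have single: "\<delta> {v} = 0" if "v \<in> carrier_vec k" for v
    using diversity_singleton[OF div that] .
  have pow_le: "\<delta> (A [^]\<^bsub>?G\<^esub> n) \<le> real n * \<delta> A" if A: "A \<in> carrier ?G" for A and n :: nat
  proof (induction n)
    case 0
    show ?case by (simp add: one_minkowski single)
  next
    case (Suc n)
    with sub[of "A [^]\<^bsub>?G\<^esub> n" A] A show ?case by (simp add: algebra_simps)
  qed
  have pow: "\<delta> (A [^]\<^bsub>?G\<^esub> n) = real n * \<delta> A" if A: "A \<in> carrier ?G" for A and n :: nat
  proof (rule antisym)
    show "real n * \<delta> A \<le> \<delta> (A [^]\<^bsub>?G\<^esub> n)"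
      using mono[OF smult_subset_pow_minkowski[OF A, of n]] hom[of "real n" A] A by simp
  qed (rule pow_le[OF A])
  have inc: "\<delta> A \<le> \<delta> (A \<otimes>\<^bsub>?G\<^esub> B)" if A: "A \<in> carrier ?G" and B: "B \<in> carrier ?G" for A B
  proof -
    obtain b where b: "b \<in> B" "b \<in> carrier_vec k" using B by (auto simp: carrier_minkowski)
    then have sing: "{b} \<in> carrier ?G" "{- b} \<in> carrier ?G" by (auto simp: carrier_minkowski)
    have "(A \<otimes>\<^bsub>?G\<^esub> {b}) \<otimes>\<^bsub>?G\<^esub> {- b} = A \<otimes>\<^bsub>?G\<^esub> ({b} \<otimes>\<^bsub>?G\<^esub> {- b})"
      using A sing by (simp add: m_assoc)
    also have "{b} \<otimes>\<^bsub>?G\<^esub> {- b} = \<one>\<^bsub>?G\<^esub>"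
      using b by (auto simp: mult_minkowski one_minkowski)
    finally have "\<delta> A = \<delta> ((A \<otimes>\<^bsub>?G\<^esub> {b}) \<otimes>\<^bsub>?G\<^esub> {- b})" using A by simp
    also have "\<dots> \<le> \<delta> (A \<otimes>\<^bsub>?G\<^esub> {b}) + \<delta> {- b}" using A sing by (intro sub) auto
    also have "\<delta> {- b} = 0" using b by (intro single) auto
    also have "\<delta> (A \<otimes>\<^bsub>?G\<^esub> {b}) \<le> \<delta> (A \<otimes>\<^bsub>?G\<^esub> B)"
    proof (rule mono)
      show "A \<otimes>\<^bsub>?G\<^esub> {b} \<subseteq> A \<otimes>\<^bsub>?G\<^esub> B"
        using b by (auto simp: mult_minkowski)
    qed (use A B in auto)
    finally show ?thesis by simp
  qed
  show ?thesis
    unfolding gauge_def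
    by (intro conjI ballI allI impI; rule sub pow inc mono; assumption)
qed

text \<open>
  An additive minorant of \<open>\<delta>'\<close> on the images of the nonempty subsets of \<open>X\<close>, pulled back to
  \<open>X\<close>.  It vanishes on points since it lies between zero and \<open>\<delta>'\<close>.  The empty set is not in the
  Minkowski monoid, so it is treated apart.
\<close>

lemma submodular_minorant_of_sublinear:
  assumes X: "finite X" and sl: "sublinear_diversity k \<delta>'"
    and emb: "diversity_embedding X \<delta> (carrier_vec k) \<delta>' \<phi>" and A0: "A0 \<subseteq> X"
  shows "\<exists>d. submodular_diversity X d \<and> (\<forall>A\<subseteq>X. d A \<le> \<delta> A) \<and> d A0 = \<delta> A0"
proof -
  let ?G = "minkowski_monoid k"
  note G = comm_monoid_minkowski[of k]
  interpret comm_monoid ?G by (rule G)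
  have div: "diversity (carrier_vec k) \<delta>'" using sl by (simp add: sublinear_diversity_def)
  have \<phi>: "\<phi> x \<in> carrier_vec k" if "x \<in> X" for x
    using emb that by (auto simp: diversity_embedding_def)
  have fin: "finite A" if "A \<subseteq> X" for A using X that finite_subset by blast
  have \<delta>': "\<delta>' (\<phi> ` A) = \<delta> A" if "A \<subseteq> X" for A
    using emb fin that by (auto simp: diversity_embedding_def)
  have \<phi>G: "\<phi> ` A \<in> carrier ?G" if "A \<subseteq> X" "A \<noteq> {}" for A
    using that \<phi> fin by (auto simp: carrier_minkowski)
  have compat: "A \<otimes>\<^bsub>?G\<^esub> C \<subseteq> B \<otimes>\<^bsub>?G\<^esub> C" if "A \<subseteq> B" for A B C
    using that by (auto simp: mult_minkowski)
  have \<delta>_empty: "\<delta> {} = 0" using \<delta>'[of "{}"] diversity_empty[OF div] by simp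
  show ?thesis
  proof (cases "A0 = {}")
    case True
    have "submodular_diversity X (\<lambda>A. 0)" by (rule submodular_diversityI) auto
    moreover have "0 \<le> \<delta> A" if "A \<subseteq> X" for A
      using diversity_nonneg[OF div, of "\<phi> ` A"] \<delta>'[OF that] fin[OF that] \<phi> that by auto
    ultimately show ?thesis using True \<delta>_empty by (intro exI[of _ "\<lambda>A. 0"]) auto
  next
    case False
    let ?B = "(\<lambda>A. \<phi> ` A) ` (Pow X - {{}})"
    have "\<exists>g. gauge ?G (\<subseteq>) g \<and> (\<forall>x\<in>carrier ?G. g x \<le> \<delta>' x) \<and> g (\<phi> ` A0) = \<delta>' (\<phi> ` A0) \<and>
      (\<forall>b\<in>insert (\<phi> ` A0) ?B. additive_along ?G g b)"
      by (rule gauge_minorant_additive_on_finite[OF G sublinear_diversity_gauge[OF sl] compat])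
        (use \<phi>G A0 False X in auto)
    then obtain g where g: "gauge ?G (\<subseteq>) g" and g_le: "\<And>K. K \<in> carrier ?G \<Longrightarrow> g K \<le> \<delta>' K"
      and gA0: "g (\<phi> ` A0) = \<delta>' (\<phi> ` A0)"
      and add: "\<And>A. A \<subseteq> X \<Longrightarrow> A \<noteq> {} \<Longrightarrow> additive_along ?G g (\<phi> ` A)"
      by auto
    define d where "d A = (if A = {} then 0 else g (\<phi> ` A))" for A
    have g_mono: "g K \<le> g K'" if "K \<in> carrier ?G" "K' \<in> carrier ?G" "K \<subseteq> K'" for K K'
      using g that unfolding gauge_def by blast
    have d_nonneg: "0 \<le> d A" if "A \<subseteq> X" for A
      using gauge_nonneg[OF G g \<phi>G[OF that]] by (simp add: d_def)
    have d_le: "d A \<le> \<delta> A" if "A \<subseteq> X" for A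
      using g_le[OF \<phi>G[OF that]] \<delta>'[OF that] \<delta>_empty by (simp add: d_def)
    have "submodular_diversity X d"
    proof (rule submodular_diversityI)
      show "d {x} = 0" if "x \<in> X" for x
        using d_nonneg[of "{x}"] d_le[of "{x}"] \<delta>'[of "{x}"]
          diversity_singleton[OF div \<phi>[OF that]] that by simp
      show "d A \<le> d B" if "A \<subseteq> B" "finite B" "B \<subseteq> X" for A B
      proof (cases "A = {}")
        case True
        then show ?thesis using d_nonneg[OF that(3)] by (simp add: d_def)
      next
        case False
        then have "B \<noteq> {}" using that by auto
        then show ?thesis
          using g_mono[OF \<phi>G \<phi>G, of A B] that False by (auto simp: d_def)
      qed
      show "d (A \<union> B) + d (A \<inter> B) \<le> d A + d B"
        if *: "A \<subseteq> X" "B \<subseteq> X" "A \<inter> B \<noteq> {}" for A B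
      proof -
        have ne: "A \<noteq> {}" "B \<noteq> {}" "A \<union> B \<noteq> {}" "A \<union> B \<subseteq> X" "A \<inter> B \<subseteq> X" using * by auto
        note G' = \<phi>G[OF *(1) ne(1)] \<phi>G[OF *(2) ne(2)] \<phi>G[OF ne(4,3)] \<phi>G[OF ne(5) *(3)]
        \<comment> \<open>A point of the intersection can be paired with a point of either set.\<close>
        have "\<phi> ` (A \<union> B) \<otimes>\<^bsub>?G\<^esub> \<phi> ` (A \<inter> B) \<subseteq> \<phi> ` A \<otimes>\<^bsub>?G\<^esub> \<phi> ` B"
        proof
          fix v assume "v \<in> \<phi> ` (A \<union> B) \<otimes>\<^bsub>?G\<^esub> \<phi> ` (A \<inter> B)"
          then obtain x y where xy: "x \<in> A \<union> B" "y \<in> A \<inter> B" "v = \<phi> x + \<phi> y"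
            by (auto simp: mult_minkowski)
          have "\<phi> x \<in> carrier_vec k" "\<phi> y \<in> carrier_vec k" using xy \<phi> * by auto
          then have "v = \<phi> y + \<phi> x" using xy(3) comm_add_vec by blast
          then have "\<exists>a\<in>A. \<exists>b\<in>B. v = \<phi> a + \<phi> b"
            using xy by (cases "x \<in> B") blast+
          then show "v \<in> \<phi> ` A \<otimes>\<^bsub>?G\<^esub> \<phi> ` B"
            by (auto simp: mult_minkowski)
        qed
        then have "g (\<phi> ` (A \<union> B) \<otimes>\<^bsub>?G\<^esub> \<phi> ` (A \<inter> B)) \<le> g (\<phi> ` A \<otimes>\<^bsub>?G\<^esub> \<phi> ` B)"
          by (intro g_mono m_closed G')
        moreover have "g (\<phi> ` (A \<union> B) \<otimes>\<^bsub>?G\<^esub> \<phi> ` (A \<inter> B)) = g (\<phi> ` (A \<union> B)) + g (\<phi> ` (A \<inter> B))"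
          using add[OF ne(5) *(3)] G' unfolding additive_along_def by blast
        moreover have "g (\<phi> ` A \<otimes>\<^bsub>?G\<^esub> \<phi> ` B) = g (\<phi> ` A) + g (\<phi> ` B)"
          using add[OF *(2) ne(2)] G' unfolding additive_along_def by blast
        ultimately show ?thesis using ne *(3) by (auto simp: d_def)
      qed
    qed (simp add: d_def)
    moreover have "d A0 = \<delta> A0" using gA0 \<delta>'[OF A0] False by (simp add: d_def)
    ultimately show ?thesis using d_le by blast
  qed
qed

section \<open>From submodular to sublinear diversities\<close>

definition support_sum :: "nat \<Rightarrow> (nat \<Rightarrow> real vec) \<Rightarrow> real vec set \<Rightarrow> real" where
  "support_sum m w K = (if K = {} then 0 else \<Sum>i\<le>m. Max ((\<lambda>v. w i \<bullet> v) ` K))"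

text \<open>
  Support functions are additive under Minkowski sums.  The condition that the functionals sum to
  zero makes points have value zero; it also gives the triangle inequality, because a maximum of
  \<open>w i\<close> over \<open>A \<union> C\<close> is attained in \<open>A\<close> or in \<open>C\<close> and the other term on the right is
  at least \<open>w i \<bullet> b\<close> for any fixed \<open>b \<in> B\<close>.
\<close>

lemma sublinear_support_sum:
  assumes w: "\<And>i. i \<le> m \<Longrightarrow> w i \<in> carrier_vec k"
    and zero: "\<And>v. v \<in> carrier_vec k \<Longrightarrow> (\<Sum>i\<le>m. w i \<bullet> v) = 0"
  shows "sublinear_diversity k (support_sum m w)"
proof -
  define h where "h i K = Max ((\<lambda>v. w i \<bullet> v) ` K)" for i K
  have L: "support_sum m w K = (\<Sum>i\<le>m. h i K)" if "K \<noteq> {}" for K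
    using that by (simp add: support_sum_def h_def)
  have h_ge: "w i \<bullet> v \<le> h i K" if "finite K" "v \<in> K" for i v K
    using that by (simp add: h_def)
  have h_ex: "\<exists>v\<in>K. h i K = w i \<bullet> v" if "finite K" "K \<noteq> {}" for i K
  proof -
    have "h i K \<in> (\<lambda>v. w i \<bullet> v) ` K"
      unfolding h_def by (rule Max_in) (use that in auto)
    then show ?thesis by auto
  qed
  have nonneg: "0 \<le> support_sum m w K" if K: "finite K" "K \<subseteq> carrier_vec k" for K
  proof (cases "K = {}")
    case False
    then obtain v where v: "v \<in> K" by auto
    have "0 = (\<Sum>i\<le>m. w i \<bullet> v)" using zero v K by auto
    also have "\<dots> \<le> (\<Sum>i\<le>m. h i K)" by (intro sum_mono h_ge K v)
    finally show ?thesis using L False by simp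
  qed (simp add: support_sum_def)
  have D1: "support_sum m w A = 0" if "finite A" "A \<subseteq> carrier_vec k" "card A \<le> 1" for A
  proof (cases "A = {}")
    case False
    with that have "card A = 1" by (simp add: le_Suc_eq)
    then obtain v where "A = {v}" by (rule card_1_singletonE)
    with that zero show ?thesis by (simp add: support_sum_def)
  qed (simp add: support_sum_def)
  have D2: "support_sum m w (A \<union> C) \<le> support_sum m w (A \<union> B) + support_sum m w (B \<union> C)"
    if *: "finite A" "A \<subseteq> carrier_vec k" "finite B" "B \<subseteq> carrier_vec k" "finite C"
      "C \<subseteq> carrier_vec k" "B \<noteq> {}" for A B C
  proof (cases "A \<union> C = {}")
    case True
    with nonneg[of B] * show ?thesis by (simp add: support_sum_def)
  next
    case False
    obtain b where b: "b \<in> B" using * by auto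
    have "h i (A \<union> C) + w i \<bullet> b \<le> h i (A \<union> B) + h i (B \<union> C)" for i
    proof -
      obtain v where v: "v \<in> A \<union> C" "h i (A \<union> C) = w i \<bullet> v"
        using h_ex[of "A \<union> C" i] False * by auto
      show ?thesis
      proof (cases "v \<in> A")
        case True
        then show ?thesis using h_ge[of "A \<union> B" v i] h_ge[of "B \<union> C" b i] v b * by auto
      next
        case False
        then show ?thesis using h_ge[of "A \<union> B" b i] h_ge[of "B \<union> C" v i] v b * by auto
      qed
    qed
    then have "(\<Sum>i\<le>m. h i (A \<union> C) + w i \<bullet> b) \<le> (\<Sum>i\<le>m. h i (A \<union> B) + h i (B \<union> C))"
      by (intro sum_mono)
    moreover have "(\<Sum>i\<le>m. w i \<bullet> b) = 0" using zero b * by auto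
    ultimately show ?thesis using L False * by (simp add: sum.distrib)
  qed
  have hom: "support_sum m w ((\<lambda>a. c \<cdot>\<^sub>v a) ` A) = c * support_sum m w A"
    if *: "0 \<le> c" "finite A" "A \<noteq> {}" "A \<subseteq> carrier_vec k" for c A
  proof -
    have "h i ((\<lambda>a. c \<cdot>\<^sub>v a) ` A) = c * h i A" if i: "i \<le> m" for i
    proof -
      have "w i \<bullet> (c \<cdot>\<^sub>v a) = c * (w i \<bullet> a)" if "a \<in> A" for a
        using that * w[OF i] by (meson scalar_prod_smult_distrib subsetD)
      then have "(\<lambda>v. w i \<bullet> v) ` (\<lambda>a. c \<cdot>\<^sub>v a) ` A = (\<lambda>r. c * r) ` (\<lambda>v. w i \<bullet> v) ` A"
        unfolding image_image by (rule image_cong[OF refl])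
      moreover have "mono (\<lambda>r. c * r)" using *(1) by (auto intro!: monoI mult_left_mono)
      ultimately show ?thesis
        unfolding h_def using mono_Max_commute[of "\<lambda>r. c * r" "(\<lambda>v. w i \<bullet> v) ` A"] * by simp
    qed
    then show ?thesis using L * by (simp add: sum_distrib_left)
  qed
  have sub: "support_sum m w {a + b |a b. a \<in> A \<and> b \<in> B} \<le> support_sum m w A + support_sum m w B"
    if *: "finite A" "A \<noteq> {}" "A \<subseteq> carrier_vec k" "finite B" "B \<noteq> {}" "B \<subseteq> carrier_vec k" for A B
  proof -
    let ?S = "{a + b |a b. a \<in> A \<and> b \<in> B}"
    have S: "finite ?S" "?S \<noteq> {}" using * by (auto intro: finite_image_set2)
    have "h i ?S \<le> h i A + h i B" if i: "i \<le> m" for i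
    proof -
      obtain a b where ab: "a \<in> A" "b \<in> B" "h i ?S = w i \<bullet> (a + b)"
        using h_ex[OF S, of i] by blast
      have "w i \<bullet> (a + b) = w i \<bullet> a + w i \<bullet> b"
        using ab * by (intro scalar_prod_add_distrib[OF w[OF i]]) auto
      then show ?thesis using ab h_ge[of A a i] h_ge[of B b i] * by simp
    qed
    then have "(\<Sum>i\<le>m. h i ?S) \<le> (\<Sum>i\<le>m. h i A + h i B)" by (intro sum_mono) auto
    then show ?thesis using L * S(2) by (simp add: sum.distrib)
  qed
  show ?thesis
    unfolding sublinear_diversity_def diversity_def
    by (intro conjI allI impI; elim conjE; rule D1 D2 hom sub; assumption)
qed

lemma sublinear_diversity_Max:
  assumes F: "finite F" "F \<noteq> {}" and D: "\<And>D. D \<in> F \<Longrightarrow> sublinear_diversity k D"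
  shows "sublinear_diversity k (\<lambda>K. Max ((\<lambda>D. D K) ` F))"
proof -
  let ?M = "\<lambda>K. Max ((\<lambda>D. D K) ` F)"
  have ge: "D K \<le> ?M K" if "D \<in> F" for D K using F that by simp
  have le: "?M K \<le> r" if "\<And>D. D \<in> F \<Longrightarrow> D K \<le> r" for K r using F that by simp
  have D1: "?M A = 0" if "finite A" "A \<subseteq> carrier_vec k" "card A \<le> 1" for A
  proof -
    have "D A = 0" if "D \<in> F" for D
      using D[OF that] \<open>finite A\<close> \<open>A \<subseteq> carrier_vec k\<close> \<open>card A \<le> 1\<close>
      unfolding sublinear_diversity_def diversity_def by blast
    then have "(\<lambda>D. D A) ` F = (\<lambda>D. 0) ` F" by (intro image_cong refl)
    then have "(\<lambda>D. D A) ` F = {0}" using F by (simp add: image_constant_conv)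
    then show ?thesis by simp
  qed
  have D2: "?M (A \<union> C) \<le> ?M (A \<union> B) + ?M (B \<union> C)"
    if *: "finite A" "A \<subseteq> carrier_vec k" "finite B" "B \<subseteq> carrier_vec k" "finite C"
      "C \<subseteq> carrier_vec k" "B \<noteq> {}" for A B C
  proof (rule le)
    fix D assume DF: "D \<in> F"
    have "D (A \<union> C) \<le> D (A \<union> B) + D (B \<union> C)"
      using D[OF DF] * by (intro diversity_D2[of "carrier_vec k"]) (auto simp: sublinear_diversity_def)
    then show "D (A \<union> C) \<le> ?M (A \<union> B) + ?M (B \<union> C)"
      using ge[OF DF, of "A \<union> B"] ge[OF DF, of "B \<union> C"] by linarith
  qed
  have hom: "?M ((\<lambda>a. c \<cdot>\<^sub>v a) ` A) = c * ?M A"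
    if *: "0 \<le> c" "finite A" "A \<noteq> {}" "A \<subseteq> carrier_vec k" for c A
  proof -
    have "D ((\<lambda>a. c \<cdot>\<^sub>v a) ` A) = c * D A" if "D \<in> F" for D
      using D[OF that] * unfolding sublinear_diversity_def by blast
    then have "(\<lambda>D. D ((\<lambda>a. c \<cdot>\<^sub>v a) ` A)) ` F = (\<lambda>r. c * r) ` (\<lambda>D. D A) ` F"
      unfolding image_image by (rule image_cong[OF refl])
    moreover have "mono (\<lambda>r. c * r)" using *(1) by (auto intro!: monoI mult_left_mono)
    ultimately show ?thesis
      using mono_Max_commute[of "\<lambda>r. c * r" "(\<lambda>D. D A) ` F"] F by simp
  qed
  have sub: "?M {a + b |a b. a \<in> A \<and> b \<in> B} \<le> ?M A + ?M B"
    if *: "finite A" "A \<noteq> {}" "A \<subseteq> carrier_vec k" "finite B" "B \<noteq> {}" "B \<subseteq> carrier_vec k" for A B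
  proof (rule le)
    fix D assume DF: "D \<in> F"
    have "D {a + b |a b. a \<in> A \<and> b \<in> B} \<le> D A + D B"
      using D[OF DF] * unfolding sublinear_diversity_def by blast
    then show "D {a + b |a b. a \<in> A \<and> b \<in> B} \<le> ?M A + ?M B"
      using ge[OF DF, of A] ge[OF DF, of B] by linarith
  qed
  show ?thesis
    unfolding sublinear_diversity_def diversity_def
    by (intro conjI allI impI; elim conjE; rule D1 D2 hom sub; assumption)
qed

text \<open>
  The functions \<open>u i\<close> are the negative marginal values of the elements of \<open>A0\<close>, taken in a fixed
  order and seen from the point \<open>x\<close>.  Submodularity makes marginal values decrease when \<open>{x}\<close> grows
  to \<open>S\<close>, so the sum of the maxima over \<open>S\<close> is at most the telescoping sum of the marginals
  seen from \<open>S\<close>.  At \<open>S = A0\<close> the \<open>i\<close>-th maximum is zero: the \<open>i\<close>-th element of \<open>A0\<close>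
  has marginal value zero when seen from itself.
\<close>

lemma submodular_support_minorant:
  fixes X :: "'a set"
  assumes X: "finite X" and d: "submodular_diversity X d" and A0: "A0 \<subseteq> X"
  obtains m :: nat and u :: "nat \<Rightarrow> 'a \<Rightarrow> real" where
    "\<And>x. x \<in> X \<Longrightarrow> (\<Sum>i\<le>m. u i x) = 0"
    "\<And>S. S \<subseteq> X \<Longrightarrow> S \<noteq> {} \<Longrightarrow> (\<Sum>i\<le>m. Max (u i ` S)) \<le> d S"
    "A0 \<noteq> {} \<Longrightarrow> (\<Sum>i\<le>m. Max (u i ` A0)) = d A0"
proof -
  have div: "diversity X d" using d by (simp add: submodular_diversity_def)
  have fin: "finite S" if "S \<subseteq> X" for S using X that finite_subset by blast
  have mono: "d S \<le> d T" if "S \<subseteq> T" "T \<subseteq> X" for S T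
    using diversity_mono[OF div fin] that by blast
  have submod: "d (S \<union> T) + d (S \<inter> T) \<le> d S + d T"
    if "S \<subseteq> X" "T \<subseteq> X" "S \<inter> T \<noteq> {}" for S T
    using d fin that unfolding submodular_diversity_def by blast
  \<comment> \<open>A repeated entry of the list only contributes a function that is identically zero.\<close>
  obtain ys where ys: "set ys = A0" using finite_list fin[OF A0] by blast
  define m where "m = length ys"
  define Y where "Y i = set (take i ys)" for i
  have Y_sub: "Y i \<subseteq> X" for i using set_take_subset[of i ys] ys A0 by (auto simp: Y_def)
  have Y_0: "Y 0 = {}" and Y_m: "Y m = A0" by (simp_all add: Y_def m_def ys)
  have Y_Suc: "Y (Suc i) = insert (ys ! i) (Y i)" if "i < m" for i
    using that by (simp add: Y_def m_def take_Suc_conv_app_nth)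
  define u where "u i x = (if i < m then d (Y i \<union> {x}) - d (Y (Suc i) \<union> {x}) else d (A0 \<union> {x}))"
    for i x
  have telescope: "(\<Sum>i<m. d (Y i \<union> S) - d (Y (Suc i) \<union> S)) = d S - d (A0 \<union> S)" for S
    using sum_lessThan_telescope'[of "\<lambda>i. d (Y i \<union> S)" m] by (simp add: Y_0 Y_m)
  have split: "(\<Sum>i\<le>m. F i) = (\<Sum>i<m. F i) + F m" for F :: "nat \<Rightarrow> real"
    by (simp add: lessThan_Suc_atMost[symmetric])
  have zero: "(\<Sum>i\<le>m. u i x) = 0" if "x \<in> X" for x
    using telescope[of "{x}"] diversity_singleton[OF div that] by (simp add: split u_def)
  have le: "(\<Sum>i\<le>m. Max (u i ` S)) \<le> d S" if S: "S \<subseteq> X" "S \<noteq> {}" for S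
  proof -
    have "Max (u i ` S) \<le> d (Y i \<union> S) - d (Y (Suc i) \<union> S)" if i: "i < m" for i
    proof (rule Max.boundedI)
      fix r assume "r \<in> u i ` S"
      then obtain x where x: "x \<in> S" "r = u i x" by auto
      have "d ((Y (Suc i) \<union> {x}) \<union> (Y i \<union> S)) + d ((Y (Suc i) \<union> {x}) \<inter> (Y i \<union> S))
          \<le> d (Y (Suc i) \<union> {x}) + d (Y i \<union> S)"
        by (rule submod) (use Y_sub S x in auto)
      moreover have "(Y (Suc i) \<union> {x}) \<union> (Y i \<union> S) = Y (Suc i) \<union> S"
        using x Y_Suc[OF i] by auto
      moreover have "d (Y i \<union> {x}) \<le> d ((Y (Suc i) \<union> {x}) \<inter> (Y i \<union> S))"
        by (rule mono) (use x Y_Suc[OF i] Y_sub S in auto)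
      ultimately show "r \<le> d (Y i \<union> S) - d (Y (Suc i) \<union> S)"
        using x i by (simp add: u_def)
    qed (use fin S in auto)
    then have "(\<Sum>i<m. Max (u i ` S)) \<le> (\<Sum>i<m. d (Y i \<union> S) - d (Y (Suc i) \<union> S))"
      by (intro sum_mono) auto
    moreover have "Max (u m ` S) \<le> d (A0 \<union> S)"
      using fin[OF S(1)] S A0 by (auto simp: u_def intro!: mono)
    ultimately show ?thesis using telescope[of S] by (simp add: split)
  qed
  have "(\<Sum>i\<le>m. Max (u i ` A0)) = d A0" if ne: "A0 \<noteq> {}"
  proof (rule antisym[OF le[OF A0 ne]])
    have "0 \<le> Max (u i ` A0)" if i: "i < m" for i
    proof -
      have "ys ! i \<in> A0" using i ys by (auto simp: m_def)
      moreover have "u i (ys ! i) = 0" using i Y_Suc[OF i] by (simp add: u_def)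
      ultimately show ?thesis using fin[OF A0] by (metis Max_ge finite_imageI imageI)
    qed
    then have "0 \<le> (\<Sum>i<m. Max (u i ` A0))" by (intro sum_nonneg) auto
    moreover have "u m ` A0 = {d A0}"
      using ne by (auto simp: u_def insert_absorb)
    ultimately show "d A0 \<le> (\<Sum>i\<le>m. Max (u i ` A0))" by (simp add: split)
  qed
  with zero le show thesis by (rule that)
qed

text \<open>
  Unit vectors form a basis, so the functions \<open>u i\<close> extend to linear functionals whose sum is zero on
  the whole space.  The embedding does not depend on \<open>A0\<close> or on \<open>d\<close>; hence such diversities live
  on a common space and their maximum can be taken.
\<close>

lemma sublinear_minorant_of_submodular:
  fixes X :: "'a set"
  assumes X: "finite X" and idx: "bij_betw idx X {..<k}"
    and d: "submodular_diversity X d" and A0: "A0 \<subseteq> X"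
  shows "\<exists>D. sublinear_diversity k D \<and> (\<forall>A\<subseteq>X. D ((\<lambda>x. unit_vec k (idx x)) ` A) \<le> d A) \<and>
    D ((\<lambda>x. unit_vec k (idx x)) ` A0) = d A0"
proof -
  let ?\<phi> = "\<lambda>x. unit_vec k (idx x) :: real vec"
  obtain m :: nat and u :: "nat \<Rightarrow> 'a \<Rightarrow> real"
    where zero: "\<And>x. x \<in> X \<Longrightarrow> (\<Sum>i\<le>m. u i x) = 0"
    and le: "\<And>S. S \<subseteq> X \<Longrightarrow> S \<noteq> {} \<Longrightarrow> (\<Sum>i\<le>m. Max (u i ` S)) \<le> d S"
    and eq: "A0 \<noteq> {} \<Longrightarrow> (\<Sum>i\<le>m. Max (u i ` A0)) = d A0"
    by (rule submodular_support_minorant[OF X d A0]) (rule that; assumption)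
  define w where "w i = vec k (\<lambda>j. u i (inv_into X idx j))" for i :: nat
  have inv_X: "inv_into X idx j \<in> X" if "j < k" for j
    using idx that by (metis bij_betw_def inv_into_into lessThan_iff)
  have w: "w i \<in> carrier_vec k" for i by (simp add: w_def)
  have w_unit: "w i \<bullet> ?\<phi> x = u i x" if "x \<in> X" for i x
  proof -
    have "idx x < k" using idx that by (auto simp: bij_betw_def)
    moreover have "inv_into X idx (idx x) = x" using idx that by (simp add: bij_betw_def)
    ultimately show ?thesis by (simp add: scalar_prod_right_unit w_def)
  qed
  have sub: "sublinear_diversity k (support_sum m w)"
  proof (rule sublinear_support_sum[OF w])
    fix v :: "real vec" assume v: "v \<in> carrier_vec k"
    have "(\<Sum>i\<le>m. w i \<bullet> v) = (\<Sum>i\<le>m. \<Sum>j<k. u i (inv_into X idx j) * v $ j)"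
      using v by (simp add: scalar_prod_def w_def atLeast0LessThan)
    also have "\<dots> = (\<Sum>j<k. (\<Sum>i\<le>m. u i (inv_into X idx j)) * v $ j)"
      by (subst sum.swap) (simp add: sum_distrib_right)
    also have "\<dots> = 0" by (simp add: zero inv_X)
    finally show "(\<Sum>i\<le>m. w i \<bullet> v) = 0" .
  qed
  have val: "support_sum m w (?\<phi> ` A) = (\<Sum>i\<le>m. Max (u i ` A))" if A: "A \<subseteq> X" "A \<noteq> {}" for A
  proof -
    have "(\<lambda>v. w i \<bullet> v) ` ?\<phi> ` A = u i ` A" for i
      unfolding image_image by (rule image_cong) (use A w_unit in auto)
    then show ?thesis using A by (simp add: support_sum_def)
  qed
  have d_empty: "d {} = 0" using d diversity_empty by (auto simp: submodular_diversity_def)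
  have "support_sum m w (?\<phi> ` A) \<le> d A" if "A \<subseteq> X" for A
    by (cases "A = {}") (use val le that d_empty in \<open>auto simp: support_sum_def\<close>)
  moreover have "support_sum m w (?\<phi> ` A0) = d A0"
    by (cases "A0 = {}") (use val eq A0 d_empty in \<open>auto simp: support_sum_def\<close>)
  ultimately show ?thesis using sub by blast
qed

section \<open>Sublinear-embeddable finite diversities\<close>

theorem theorem16:
  fixes X :: "'a set" and \<delta> :: "'a set \<Rightarrow> real"
  assumes "finite X" and "diversity X \<delta>"
  shows "sublinear_embeddable X \<delta> \<longleftrightarrow>
    (\<exists>(m::nat) (d :: nat \<Rightarrow> 'a set \<Rightarrow> real). 1 \<le> m \<and>
       (\<forall>i\<in>{1..m}. submodular_diversity X (d i)) \<and>
       (\<forall>A. A \<subseteq> X \<longrightarrow> \<delta> A = Max ((\<lambda>i. d i A) ` {1..m})))"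
    (is "_ \<longleftrightarrow> ?rhs")
proof
  assume "sublinear_embeddable X \<delta>"
  then obtain k \<delta>' \<phi> where "sublinear_diversity k \<delta>'"
    "diversity_embedding X \<delta> (carrier_vec k) \<delta>' \<phi>"
    by (auto simp: sublinear_embeddable_def)
  then have "\<forall>A0\<in>Pow X. \<exists>d. submodular_diversity X d \<and> (\<forall>A\<subseteq>X. d A \<le> \<delta> A) \<and> d A0 = \<delta> A0"
    using submodular_minorant_of_sublinear[OF assms(1)] by blast
  from bchoice[OF this] obtain e where "\<forall>A0\<in>Pow X. submodular_diversity X (e A0) \<and>
      (\<forall>A\<subseteq>X. e A0 A \<le> \<delta> A) \<and> e A0 A0 = \<delta> A0" ..
  then have e: "submodular_diversity X (e A0)" "A \<subseteq> X \<Longrightarrow> e A0 A \<le> \<delta> A" "e A0 A0 = \<delta> A0"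
    if "A0 \<subseteq> X" for A0 A
    using that by simp_all
  have "finite (Pow X)" using assms(1) by simp
  then obtain p where p: "bij_betw p {1..card (Pow X)} (Pow X)"
    using ex_bij_betw_nat_finite_1 by blast
  then have p_img: "p ` {1..card (Pow X)} = Pow X" by (simp add: bij_betw_def)
  have "\<delta> A = Max ((\<lambda>i. e (p i) A) ` {1..card (Pow X)})" if A: "A \<subseteq> X" for A
  proof (rule Max_eqI[symmetric])
    have "A \<in> p ` {1..card (Pow X)}" using A p_img by simp
    then show "\<delta> A \<in> (\<lambda>i. e (p i) A) ` {1..card (Pow X)}" using e(3)[OF A] by force
    show "r \<le> \<delta> A" if "r \<in> (\<lambda>i. e (p i) A) ` {1..card (Pow X)}" for r
      using that e(2)[OF _ A] p_img by blast
  qed simp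
  moreover have "\<forall>i\<in>{1..card (Pow X)}. submodular_diversity X (e (p i))"
    using e(1) p_img by blast
  moreover have "1 \<le> card (Pow X)" using assms(1) by (simp add: card_Pow)
  ultimately show ?rhs by (intro exI[of _ "card (Pow X)"] exI[of _ "\<lambda>i. e (p i)"]) simp
next
  assume ?rhs
  then obtain m d where m: "1 \<le> (m::nat)" and sub: "\<And>i. i \<in> {1..m} \<Longrightarrow> submodular_diversity X (d i)"
    and max: "\<And>A. A \<subseteq> X \<Longrightarrow> \<delta> A = Max ((\<lambda>i. d i A) ` {1..m})"
    by blast
  obtain idx where idx: "bij_betw idx X {..<card X}"
    using ex_bij_betw_finite_nat[OF assms(1)] by (auto simp: atLeast0LessThan)
  let ?\<phi> = "\<lambda>x. unit_vec (card X) (idx x) :: real vec"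
  have "\<forall>A0\<in>Pow X. \<exists>D. sublinear_diversity (card X) D \<and> (\<forall>A\<subseteq>X. D (?\<phi> ` A) \<le> \<delta> A) \<and>
      D (?\<phi> ` A0) = \<delta> A0"
  proof
    fix A0 assume "A0 \<in> Pow X"
    then have A0: "A0 \<subseteq> X" by simp
    have "\<delta> A0 \<in> (\<lambda>i. d i A0) ` {1..m}"
      using Max_in[of "(\<lambda>i. d i A0) ` {1..m}"] m max[OF A0] by simp
    then obtain i where i: "i \<in> {1..m}" "d i A0 = \<delta> A0" by auto
    have d_le: "d i A \<le> \<delta> A" if "A \<subseteq> X" for A using max[OF that] i(1) by simp
    obtain D where "sublinear_diversity (card X) D"
      and D_le: "\<forall>A\<subseteq>X. D (?\<phi> ` A) \<le> d i A" and "D (?\<phi> ` A0) = d i A0"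
      using sublinear_minorant_of_submodular[OF assms(1) idx sub[OF i(1)] A0] by blast
    moreover have "D (?\<phi> ` A) \<le> \<delta> A" if "A \<subseteq> X" for A
      by (rule order_trans[OF _ d_le[OF that]]) (use D_le that in simp)
    ultimately show "\<exists>D. sublinear_diversity (card X) D \<and> (\<forall>A\<subseteq>X. D (?\<phi> ` A) \<le> \<delta> A) \<and>
        D (?\<phi> ` A0) = \<delta> A0"
      using i(2) by auto
  qed
  from bchoice[OF this] obtain D where "\<forall>A0\<in>Pow X. sublinear_diversity (card X) (D A0) \<and>
      (\<forall>A\<subseteq>X. D A0 (?\<phi> ` A) \<le> \<delta> A) \<and> D A0 (?\<phi> ` A0) = \<delta> A0" ..
  then have D: "sublinear_diversity (card X) (D A0)"
    "A \<subseteq> X \<Longrightarrow> D A0 (?\<phi> ` A) \<le> \<delta> A" "D A0 (?\<phi> ` A0) = \<delta> A0"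
    if "A0 \<subseteq> X" for A0 A
    using that by simp_all
  let ?M = "\<lambda>K. Max ((\<lambda>E. E K) ` D ` Pow X)"
  have "sublinear_diversity (card X) ?M"
    by (rule sublinear_diversity_Max) (use assms(1) D(1) in auto)
  moreover have "?M (?\<phi> ` A) = \<delta> A" if A: "A \<subseteq> X" for A
  proof (rule Max_eqI)
    show "\<delta> A \<in> (\<lambda>E. E (?\<phi> ` A)) ` D ` Pow X"
      using D(3)[OF A] A by (intro image_eqI[of _ _ "D A"]) auto
    show "r \<le> \<delta> A" if "r \<in> (\<lambda>E. E (?\<phi> ` A)) ` D ` Pow X" for r
      using that D(2)[OF _ A] by auto
  qed (use assms(1) in simp)
  then have "diversity_embedding X \<delta> (carrier_vec (card X)) ?M ?\<phi>"
    by (auto simp: diversity_embedding_def)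
  ultimately show "sublinear_embeddable X \<delta>"
    unfolding sublinear_embeddable_def by blast
qed

end
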